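(* Let $A$ be the Hurt-Sada array and let $\varphi=(1+\sqrt5)/2$. For $n\ge 1$ let $p(n)$ be the unique $i$ with $A[n-1,i]=n$, and let $t(n)=A[n-1,p(n)+n]$ (the last of the $n$ elements that $n$ jumps over). Then $t(n)=\lfloor (n+1)\varphi\rfloor-1$ for all $n\ge 1$.
   Context: The Hurt-Sada array $A=(A[n,k])_{n,k\ge 0}$ is defined as follows. Row $0$ is $A[0,k]=k$ for all $k\ge 0$. For $n\ge 1$, row $n$ is obtained from row $n-1$ by finding the unique occurrence of $n$ in row $n-1$, say $A[n-1,i]=n$, and shifting this entry $n$ positions to the right (it jumps over the next $n$ entries): $A[n,j]=A[n-1,j]$ for $0\le j<i$; $A[n,j]=A[n-1,j+1]$ for $i\le j<i+n$; $A[n,i+n]=n$; and $A[n,j]=A[n-1,j]$ for $j>i+n$. Each row is a permutation of $\{0,1,2,\ldots\}$. *)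

theory Defs
  imports Complex_Main
begin

definition shift_right :: "nat \<Rightarrow> (nat \<Rightarrow> nat) \<Rightarrow> nat \<Rightarrow> nat" where
  "shift_right n r =
    (let i = (THE i. r i = n) in
      (\<lambda>j. if j < i then r j
           else if j < i + n then r (j + 1)
           else if j = i + n then n
           else r j))"

primrec hurt_sada :: "nat \<Rightarrow> nat \<Rightarrow> nat" where
  "hurt_sada 0 = (\<lambda>k. k)"
| "hurt_sada (Suc n) = shift_right (Suc n) (hurt_sada n)"

text \<open>The next two functions are meant for \<open>n \<ge> 1\<close> only.\<close>

definition hs_pos :: "nat \<Rightarrow> nat" where
  "hs_pos n = (THE i. hurt_sada (n - 1) i = n)"

definition hs_last :: "nat \<Rightarrow> nat" where
  "hs_last n = hurt_sada (n - 1) (hs_pos n + n)"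

definition golden_ratio :: real where
  "golden_ratio = (1 + sqrt 5) / 2"

text \<open>Every row is a permutation of the natural numbers, so the definite descriptions above
  denote.\<close>

lemma bij_shift_right:
  assumes "bij r"
  shows "bij (shift_right n r)"
proof -
  obtain i where i: "r i = n"
    using assms by (metis bij_pointE)
  have the_i: "(THE i. r i = n) = i"
    using i assms by (auto dest: bij_is_inj injD)
  define s where "s j = (if j < i then j else if j < i + n then j + 1
    else if j = i + n then i else j)" for j
  define s' where "s' j = (if j < i then j else if j = i then i + n
    else if j \<le> i + n then j - 1 else j)" for j
  have "bij s"
    by (rule o_bij[where g = s']) (auto simp: fun_eq_iff s_def s'_def)
  moreover have "shift_right n r = r \<circ> s"
    by (auto simp: shift_right_def the_i s_def i fun_eq_iff)
  ultimately show ?thesis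
    using assms by (simp add: bij_comp)
qed

lemma bij_hurt_sada: "bij (hurt_sada n)"
proof (induction n)
  case 0
  show ?case by (simp add: bij_def)
next
  case (Suc n)
  then show ?case by (simp add: bij_shift_right)
qed

lemma ex1_hurt_sada: "\<exists>!i. hurt_sada n i = k"
  using bij_hurt_sada by (simp add: bij_iff)

end

theory Submission
  imports Defs
begin

text \<open>Write \<open>t n\<close> for \<open>\<lfloor>(n + 1)\<phi>\<rfloor> - 1\<close>. By induction on \<open>n\<close>, the entries \<open>k > n\<close> of row \<open>n\<close> have
  explicit positions: \<open>k\<close> sits at \<open>t k - (n + 1)\<close> if \<open>k \<le> t n\<close>, and still at its initial
  position \<open>k\<close> otherwise. In particular \<open>n + 1\<close> is at \<open>t (n + 1) - (n + 1)\<close>, so that it moves to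
  position \<open>t (n + 1)\<close>, where the entry was untouched so far. The only arithmetic input is that
  \<open>t k = k + n + 1\<close> whenever \<open>t n < k \<le> t (n + 1)\<close>.\<close>

text \<open>The lower Wythoff sequence, with index and value both shifted by one so that it starts
  at 0. The floor is at least \<open>k + 1\<close>, so neither \<open>nat\<close> nor the
  subtraction truncates.\<close>

definition wythoff :: "nat \<Rightarrow> nat" where
  "wythoff k = nat \<lfloor>(real k + 1) * golden_ratio\<rfloor> - 1"

lemma golden_ratio_bounds: "1 < golden_ratio" "golden_ratio < 2"
proof -
  have "1 < sqrt 5" "sqrt 5 < 3"
    by (auto intro: real_less_rsqrt real_less_lsqrt)
  then show "1 < golden_ratio" "golden_ratio < 2"
    by (auto simp: golden_ratio_def)
qed

lemma golden_ratio_square: "golden_ratio * golden_ratio = golden_ratio + 1"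
  by (simp add: golden_ratio_def field_simps)

text \<open>Irrationality by descent: \<open>a / b = \<phi>\<close> implies \<open>b / (a - b) = \<phi>\<close>.\<close>

lemma golden_ratio_irrational: "real a = real b * golden_ratio \<Longrightarrow> b = 0"
proof (induction b arbitrary: a rule: less_induct)
  case (less b)
  show ?case
  proof (rule ccontr)
    assume "b \<noteq> 0"
    then have "real b * 1 < real a" "real a < real b * 2"
      unfolding less.prems using golden_ratio_bounds by (auto intro: mult_strict_left_mono)
    then have "b < a" "a < 2 * b"
      by linarith+
    moreover have "real b = real (a - b) * golden_ratio"
      using \<open>b < a\<close> by (simp add: of_nat_diff less.prems left_diff_distrib mult.assoc golden_ratio_square
          distrib_left)
    moreover have "a - b < b"
      using \<open>b < a\<close> \<open>a < 2 * b\<close> by linarith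
    ultimately show False
      using less.IH[of "a - b" b] by (metis zero_less_diff less_irrefl)
  qed
qed

lemma floor_golden_ratio_ge: "int k + 1 \<le> \<lfloor>(real k + 1) * golden_ratio\<rfloor>"
  using golden_ratio_bounds by (simp add: le_floor_iff)

lemma of_nat_wythoff: "int (wythoff k) = \<lfloor>(real k + 1) * golden_ratio\<rfloor> - 1"
  using floor_golden_ratio_ge[of k] unfolding wythoff_def by linarith

lemma wythoff_ge: "k \<le> wythoff k"
  using floor_golden_ratio_ge[of k] of_nat_wythoff[of k] by linarith

lemma wythoff_0: "wythoff 0 = 0"
proof -
  have "\<lfloor>golden_ratio\<rfloor> = 1"
    using golden_ratio_bounds by (simp add: floor_eq_iff)
  then show ?thesis
    by (simp add: wythoff_def)
qed

lemma wythoff_strict_mono: "strict_mono wythoff"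
proof (rule strict_mono_Suc_iff[THEN iffD2], rule allI)
  fix k
  have "(real k + 1) * golden_ratio + 1 \<le> (real (Suc k) + 1) * golden_ratio"
    using golden_ratio_bounds by (simp add: algebra_simps)
  then have "\<lfloor>(real k + 1) * golden_ratio\<rfloor> + 1 \<le> \<lfloor>(real (Suc k) + 1) * golden_ratio\<rfloor>"
    by linarith
  then show "wythoff k < wythoff (Suc k)"
    using of_nat_wythoff[of k] of_nat_wythoff[of "Suc k"] by linarith
qed

text \<open>The assumptions place \<open>k + 1\<close> strictly between
  \<open>(n + 1) * \<phi>\<close> and \<open>(n + 2) * \<phi>\<close>. Multiplying by \<phi> - 1 =
  1/\<phi> puts \<open>(k + 1) * (\<phi> - 1)\<close> strictly between \<open>n + 1\<close> and
  \<open>n + 2\<close>; adding \<open>k + 1\<close> determines the floor.\<close>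

lemma wythoff_between:
  assumes "wythoff n < k" "k \<le> wythoff (Suc n)"
  shows "wythoff k = k + Suc n"
proof -
  let ?g = golden_ratio
  have lower: "(real n + 1) * ?g < real k + 1"
    using assms(1) of_nat_wythoff[of n] by linarith
  have upper: "real k + 1 \<le> (real n + 2) * ?g"
    using assms(2) of_nat_wythoff[of "Suc n"] by (simp add: add.commute algebra_simps) linarith
  \<comment> \<open>The bound \<open>k \<le> wythoff (Suc n)\<close> is not strict; irrationality of
    \<phi> makes the real inequality strict.\<close>
  have "real k + 1 \<noteq> (real n + 2) * ?g"
  proof
    assume "real k + 1 = (real n + 2) * ?g"
    then show False
      using golden_ratio_irrational[of "k + 1" "n + 2"] by (simp add: add.commute)
  qed
  with upper have upper: "real k + 1 < (real n + 2) * ?g"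
    by simp
  have "?g * (?g - 1) = 1"
    by (simp add: golden_ratio_square right_diff_distrib)
  then have inverse: "x * ?g * (?g - 1) = x" for x
    by (simp add: mult.assoc)
  have "real n + 1 < (real k + 1) * (?g - 1)"
    using mult_strict_right_mono[OF lower, of "?g - 1"] golden_ratio_bounds(1)
    by (simp only: inverse diff_gt_0_iff_gt)
  moreover have "(real k + 1) * (?g - 1) < real n + 2"
    using mult_strict_right_mono[OF upper, of "?g - 1"] golden_ratio_bounds(1)
    by (simp only: inverse diff_gt_0_iff_gt)
  ultimately have "\<lfloor>(real k + 1) * ?g\<rfloor> = int k + int n + 2"
    by (simp add: floor_eq_iff algebra_simps)
  then show ?thesis
    using of_nat_wythoff[of k] by linarith
qed

declare hurt_sada.simps(2) [simp del]

lemma the_hurt_sada: "hurt_sada n i = k \<Longrightarrow> (THE i. hurt_sada n i = k) = i"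
  by (rule the1_equality[OF ex1_hurt_sada])

lemma hurt_sada_Suc:
  assumes "hurt_sada n i = Suc n"
  shows "hurt_sada (Suc n) j =
    (if j < i then hurt_sada n j
     else if j < i + Suc n then hurt_sada n (j + 1)
     else if j = i + Suc n then Suc n
     else hurt_sada n j)"
  by (simp add: hurt_sada.simps(2) shift_right_def the_hurt_sada[OF assms])

text \<open>The position claim for row \<open>n\<close> is an assumption here, so that the lemma
  serves inside its induction as well as after it. If \<open>Suc n\<close> has not moved, its index
  is still \<open>wythoff (Suc n) - Suc n\<close>, because \<open>wythoff (Suc n)\<close> is then
  twice \<open>Suc n\<close>.\<close>

lemma hurt_sada_position_next:
  assumes "\<And>k. n < k \<Longrightarrow> hurt_sada n (if k \<le> wythoff n then wythoff k - Suc n else k) = k"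
  shows "hurt_sada n (wythoff (Suc n) - Suc n) = Suc n"
proof (cases "Suc n \<le> wythoff n")
  case True
  then show ?thesis
    using assms[of "Suc n"] by simp
next
  case False
  then have "wythoff (Suc n) = Suc n + Suc n"
    using wythoff_ge[of "Suc n"] by (intro wythoff_between) auto
  then show ?thesis
    using assms[of "Suc n"] False by simp
qed

lemma hurt_sada_position:
  "n < k \<Longrightarrow> hurt_sada n (if k \<le> wythoff n then wythoff k - Suc n else k) = k"
proof (induction n arbitrary: k)
  case 0
  then show ?case by (simp add: wythoff_0)
next
  case (Suc n)
  let ?N = "Suc n"
  have mono: "wythoff n < wythoff ?N" "wythoff ?N < wythoff k"
    using Suc.prems wythoff_strict_mono by (auto simp: strict_mono_less)
  have ge: "?N \<le> wythoff ?N"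
    by (rule wythoff_ge)
  note step = hurt_sada_Suc[OF hurt_sada_position_next[OF Suc.IH]]
  show ?case
  proof (cases "k \<le> wythoff ?N")
    \<comment> \<open>Here \<open>k\<close> lies beyond \<open>wythoff ?N\<close>, the landing
      position of \<open>?N\<close>, so this step leaves it in place.\<close>
    case False
    then show ?thesis
      using Suc.IH[of k] Suc.prems mono ge step[of k] by simp
  next
    case True
    \<comment> \<open>Evaluating at the largest admissible \<open>k\<close> bounds
      \<open>wythoff k\<close>, which shows that \<open>k\<close> is among the \<open>?N\<close>
      entries jumped over and moves one place left.\<close>
    have "wythoff (wythoff ?N) = wythoff ?N + ?N"
      using mono by (intro wythoff_between) auto
    then have "wythoff k \<le> wythoff ?N + ?N"
      using True wythoff_strict_mono by (metis strict_mono_less_eq)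
    then have "wythoff ?N - ?N \<le> wythoff k - Suc ?N" "wythoff k - Suc ?N < wythoff ?N - ?N + ?N"
      "wythoff k - Suc ?N + 1 = wythoff k - ?N"
      using mono ge by linarith+
    then have "hurt_sada ?N (wythoff k - Suc ?N) = hurt_sada n (wythoff k - ?N)"
      by (simp add: step)
    also have "\<dots> = k"
    proof (cases "k \<le> wythoff n")
      case True
      then show ?thesis
        using Suc.IH[of k] Suc.prems by simp
    next
      case False
      \<comment> \<open>In row \<open>n\<close> this \<open>k\<close> is still at its initial index,
        which coincides with \<open>wythoff k - ?N\<close>.\<close>
      then have "wythoff k = k + ?N"
        using True by (intro wythoff_between) auto
      then show ?thesis
        using Suc.IH[of k] Suc.prems False by simp
    qed
    finally show ?thesis
      using True by simp
  qed
qed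

theorem theorem7:
  fixes n :: nat
  assumes "n \<ge> 1"
  shows "int (hs_last n) = \<lfloor>(real n + 1) * golden_ratio\<rfloor> - 1"
proof -
  obtain m where n: "n = Suc m"
    using assms by (cases n) auto
  have ge: "n \<le> wythoff n"
    by (rule wythoff_ge)
  have less: "wythoff m < wythoff n"
    using wythoff_strict_mono by (simp add: n strict_mono_less)
  have "hs_pos n = wythoff n - n"
    using the_hurt_sada[OF hurt_sada_position_next[OF hurt_sada_position]] by (simp add: n hs_pos_def)
  then have "hs_last n = hurt_sada m (wythoff n)"
    using ge by (simp add: hs_last_def n)
  also have "\<dots> = wythoff n"
    using hurt_sada_position[of m "wythoff n"] less ge by (simp add: n)
  finally show ?thesis
    by (simp add: of_nat_wythoff)
qed

end
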